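(* Let $k\geq 1$ and let $d_1<d_2<\cdots<d_k$ be any (strictly) increasing sequence of positive integers. Then $d_1,\ldots,d_k$ is the sequence of generalized Hamming weights of a linear block code. In addition, for every integer $n\geq d_k$ and every prime power $q\geq n$ there exists a linear block code $\mathcal{C}\subseteq\mathbb{F}_q^n$ whose sequence of generalized Hamming weights is $d_1,\ldots,d_k$ (that is, $\dim(\mathcal{C})=k$ and $d_r(\mathcal{C})=d_r$ for all $1\leq r\leq k$). Moreover, the code $\mathcal{C}$ may always be chosen such that it satisfies the chain condition. In particular, any increasing sequence of positive integers is the sequence of greedy weights of a linear block code.
   Context: A linear block code is an $\mathbb{F}_q$-linear subspace $\mathcal{C}\subseteq\mathbb{F}_q^n$, with $q$ a prime power. For a linear subspace $\mathcal{D}\subseteq\mathbb{F}_q^n$, its support is $\mathrm{supp}(\mathcal{D})=\{i\in\{1,\ldots,n\} : c_i\neq 0 \text{ for some } c\in\mathcal{D}\}$, and its weight is $\mathrm{wt}(\mathcal{D})=|\mathrm{supp}(\mathcal{D})|$. A subcode is a linear subspace of a code. Generalized Hamming weights: for $1\leq r\leq\dim(\mathcal{C})$, $d_r(\mathcal{C})=\min\{\mathrm{wt}(\mathcal{D}) : \mathcal{D}\text{ is a subcode of }\mathcal{C},\ \dim(\mathcal{D})\geq r\}$. The sequence of generalized Hamming weights of $\mathcal{C}$ is $d_1(\mathcal{C}),\ldots,d_{\dim(\mathcal{C})}(\mathcal{C})$. Chain condition: a $k$-dimensional code $\mathcal{C}\neq 0$ satisfies the chain condition if there exists a chain of subcodes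 $0\subsetneq\mathcal{D}_1\subsetneq\mathcal{D}_2\subsetneq\cdots\subsetneq\mathcal{D}_k=\mathcal{C}$ with $\mathrm{wt}(\mathcal{D}_r)=d_r(\mathcal{C})$ for all $1\leq r\leq k$. Greedy weights: let $\mathcal{C}\neq 0$ have dimension $k$. A greedy $1$-subcode of $\mathcal{C}$ is a $1$-dimensional subcode $\mathcal{D}_1$ with $\mathrm{wt}(\mathcal{D}_1)=d_1(\mathcal{C})$. For $2\leq r\leq k$, a greedy $r$-subcode is an $r$-dimensional subcode of $\mathcal{C}$ of minimum weight among those $r$-dimensional subcodes that contain a greedy $(r-1)$-subcode. The $r$-th greedy weight is $g_r(\mathcal{C})=\mathrm{wt}(\mathcal{D}_r)$ for any greedy $r$-subcode $\mathcal{D}_r$; the sequence of greedy weights is $g_1(\mathcal{C}),\ldots,g_k(\mathcal{C})$. *)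

theory Defs
  imports "Jordan_Normal_Form.Missing_VectorSpace" "HOL-Number_Theory.Prime_Powers"
begin

text \<open>Vectors of length \<open>n\<close> over \<open>F\<close> are the extensional functions
  \<open>{1..n} \<rightarrow>\<^sub>E carrier F\<close>, with the pointwise operations. Fields are explicit records, since the
  existence of a code over some finite field has to be asserted inside a formula.\<close>

abbreviation vec_space :: "('a, 'b) ring_scheme \<Rightarrow> nat \<Rightarrow> ('a, nat \<Rightarrow> 'a) module" where
  "vec_space F n \<equiv> ring.func_space F {1..n}"

definition linear_block_code :: "('a, 'b) ring_scheme \<Rightarrow> nat \<Rightarrow> (nat \<Rightarrow> 'a) set \<Rightarrow> bool" where
  "linear_block_code F n C \<longleftrightarrow>
     field F \<and> finite (carrier F) \<and> VectorSpace.subspace F C (vec_space F n)"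

definition subcode ::
    "('a, 'b) ring_scheme \<Rightarrow> nat \<Rightarrow> (nat \<Rightarrow> 'a) set \<Rightarrow> (nat \<Rightarrow> 'a) set \<Rightarrow> bool" where
  "subcode F n C D \<longleftrightarrow> VectorSpace.subspace F D (vec_space F n) \<and> D \<subseteq> C"

definition code_dim :: "('a, 'b) ring_scheme \<Rightarrow> nat \<Rightarrow> (nat \<Rightarrow> 'a) set \<Rightarrow> nat" where
  "code_dim F n D = vectorspace.dim F ((vec_space F n)\<lparr>carrier := D\<rparr>)"

definition code_supp :: "('a, 'b) ring_scheme \<Rightarrow> nat \<Rightarrow> (nat \<Rightarrow> 'a) set \<Rightarrow> nat set" where
  "code_supp F n D = {i \<in> {1..n}. \<exists>c\<in>D. c i \<noteq> \<zero>\<^bsub>F\<^esub>}"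

definition code_wt :: "('a, 'b) ring_scheme \<Rightarrow> nat \<Rightarrow> (nat \<Rightarrow> 'a) set \<Rightarrow> nat" where
  "code_wt F n D = card (code_supp F n D)"

text \<open>Only meaningful for \<open>1 \<le> r \<le> code_dim F n C\<close>; the set of weights is then nonempty, and it is
  bounded by \<open>n\<close>.\<close>

definition gen_hamming_weight :: "('a, 'b) ring_scheme \<Rightarrow> nat \<Rightarrow> (nat \<Rightarrow> 'a) set \<Rightarrow> nat \<Rightarrow> nat" where
  "gen_hamming_weight F n C r = Min {code_wt F n D | D. subcode F n C D \<and> r \<le> code_dim F n D}"

text \<open>Sequences of weights are functions on \<open>nat\<close> of which only the values at \<open>1, \<dots>, k\<close> matter.\<close>

definition has_gen_hamming_weights ::
    "('a, 'b) ring_scheme \<Rightarrow> nat \<Rightarrow> (nat \<Rightarrow> 'a) set \<Rightarrow> nat \<Rightarrow> (nat \<Rightarrow> nat) \<Rightarrow> bool" where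
  "has_gen_hamming_weights F n C k d \<longleftrightarrow>
     code_dim F n C = k \<and> (\<forall>r\<in>{1..k}. gen_hamming_weight F n C r = d r)"

text \<open>The chain is extended by \<open>D 0 = 0\<close>, so that \<open>0 \<subset> D 1\<close> is the first of the strict inclusions.\<close>

definition chain_condition :: "('a, 'b) ring_scheme \<Rightarrow> nat \<Rightarrow> (nat \<Rightarrow> 'a) set \<Rightarrow> bool" where
  "chain_condition F n C \<longleftrightarrow>
     C \<noteq> {\<zero>\<^bsub>vec_space F n\<^esub>} \<and>
     (\<exists>D. D 0 = {\<zero>\<^bsub>vec_space F n\<^esub>} \<and> D (code_dim F n C) = C \<and>
        (\<forall>r<code_dim F n C. D r \<subset> D (Suc r)) \<and>
        (\<forall>r\<in>{1..code_dim F n C}.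
           subcode F n C (D r) \<and> code_wt F n (D r) = gen_hamming_weight F n C r))"

fun greedy_subcode ::
    "('a, 'b) ring_scheme \<Rightarrow> nat \<Rightarrow> (nat \<Rightarrow> 'a) set \<Rightarrow> nat \<Rightarrow> (nat \<Rightarrow> 'a) set \<Rightarrow> bool" where
  "greedy_subcode F n C 0 D \<longleftrightarrow> False"
| "greedy_subcode F n C (Suc 0) D \<longleftrightarrow>
     subcode F n C D \<and> code_dim F n D = 1 \<and> code_wt F n D = gen_hamming_weight F n C 1"
| "greedy_subcode F n C (Suc (Suc r)) D \<longleftrightarrow>
     is_arg_min (code_wt F n)
       (\<lambda>D. subcode F n C D \<and> code_dim F n D = Suc (Suc r) \<and>
            (\<exists>E. greedy_subcode F n C (Suc r) E \<and> E \<subseteq> D)) D"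

text \<open>All greedy \<open>r\<close>-subcodes have the same weight, by the minimality in their definition.\<close>

definition greedy_weight :: "('a, 'b) ring_scheme \<Rightarrow> nat \<Rightarrow> (nat \<Rightarrow> 'a) set \<Rightarrow> nat \<Rightarrow> nat" where
  "greedy_weight F n C r = (THE w. \<exists>D. greedy_subcode F n C r D \<and> w = code_wt F n D)"

definition has_greedy_weights ::
    "('a, 'b) ring_scheme \<Rightarrow> nat \<Rightarrow> (nat \<Rightarrow> 'a) set \<Rightarrow> nat \<Rightarrow> (nat \<Rightarrow> nat) \<Rightarrow> bool" where
  "has_greedy_weights F n C k d \<longleftrightarrow>
     code_dim F n C = k \<and> (\<forall>r\<in>{1..k}. greedy_weight F n C r = d r)"

end

theory Submission
  imports Defs "HOL-Algebra.Multiplicative_Group" "HOL-Number_Theory.Residues"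
begin

text \<open>Fix distinct points \<open>\<alpha> 1, \<dots>, \<alpha> n\<close> of the field and let \<open>p s\<close> be the polynomial of degree
  \<open>n - d s\<close> whose roots are the \<open>\<alpha> i\<close> with \<open>i > d s\<close>. The code consists of the evaluations of the
  span of \<open>p 1, \<dots>, p k\<close>. The first \<open>r\<close> generators span a subcode with support \<open>{1..d r}\<close>. Since
  the degrees are distinct, every nonzero polynomial in the span has one of the degrees
  \<open>n - d s\<close>, and an \<open>r\<close>-dimensional subspace contains one of degree at most \<open>n - d r\<close>, whose
  evaluation has weight at least \<open>d r\<close>. Dimensions over a finite field are read off from
  cardinalities. Finally, the chain condition makes every member of the chain a greedy subcode,
  so that the greedy weights are the generalized Hamming weights.\<close>

section \<open>Dimension over a finite field as a logarithm of cardinality\<close>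

lemma (in vectorspace) card_eq_power_dim:
  assumes "finite (carrier K)" and "finite (carrier V)"
  shows "card (carrier V) = card (carrier K) ^ dim"
proof -
  \<comment> \<open>The finite carrier is its own spanning set, which gives finite dimension and
    hence a finite basis.\<close>
  have "span (carrier V) = carrier V"
    using in_own_span[of "carrier V"] span_is_subset2[of "carrier V"] by auto
  then have "fin_dim"
    using assms unfolding fin_dim_def by blast
  then obtain B where B: "finite B" "basis B"
    using finite_basis_exists by blast
  then have BV: "B \<subseteq> carrier V" and dim: "dim = card B"
    using dim_basis by (auto simp: basis_def)
  have "\<exists>!a. a \<in> B \<rightarrow>\<^sub>E carrier K \<and> lincomb a B = v" if "v \<in> carrier V" for v
    using basis_criterion[OF B(1) BV] B(2) that by blast
  moreover have "lincomb a B \<in> carrier V" if "a \<in> B \<rightarrow>\<^sub>E carrier K" for a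
    using that BV by (intro lincomb_closed) auto
  \<comment> \<open>Existence and uniqueness of coordinates, with coordinate vectors taken as
    extensional functions on \<open>B\<close> so that each vector is counted once.\<close>
  ultimately have "bij_betw (\<lambda>a. lincomb a B) (B \<rightarrow>\<^sub>E carrier K) (carrier V)"
    unfolding bij_betw_def inj_on_def by (auto simp: image_iff) metis+
  then have "card (carrier V) = card (B \<rightarrow>\<^sub>E carrier K)"
    using bij_betw_same_card by metis
  then show ?thesis
    using B(1) dim by (simp add: card_PiE)
qed

context
  fixes F :: "('a, 'b) ring_scheme" (structure)
  assumes F: "field F"
begin

interpretation field F by (fact F)

lemma vectorspace_vec_space: "vectorspace F (vec_space F n)"
  using func_space_is_module F by (simp add: vectorspace_def)

lemma zero_vec_space: "\<zero>\<^bsub>vec_space F n\<^esub> = (\<lambda>i\<in>{1..n}. \<zero>)"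
  by (simp add: func_space_def)

lemma subspace_vec_space_iff:
  "VectorSpace.subspace F D (vec_space F n) \<longleftrightarrow>
     D \<subseteq> {1..n} \<rightarrow>\<^sub>E carrier F \<and> (\<lambda>i\<in>{1..n}. \<zero>) \<in> D \<and>
     (\<forall>v\<in>D. \<forall>w\<in>D. (\<lambda>i\<in>{1..n}. v i \<oplus> w i) \<in> D) \<and>
     (\<forall>c\<in>carrier F. \<forall>v\<in>D. (\<lambda>i\<in>{1..n}. c \<otimes> v i) \<in> D)"
  using func_space_is_module[of "{1..n}"] vectorspace_vec_space[of n]
  unfolding VectorSpace.subspace_def submodule_def by (auto simp: func_space_def)

context
  assumes fin: "finite (carrier F)"
begin

lemma card_carrier_gt_1: "1 < card (carrier F)"
  using fin one_not_zero
  by (metis card_le_Suc0_iff_eq not_less One_nat_def one_closed zero_closed)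

lemma finite_subspace:
  assumes "VectorSpace.subspace F D (vec_space F n)"
  shows "finite D"
proof (rule finite_subset)
  show "D \<subseteq> {1..n} \<rightarrow>\<^sub>E carrier F"
    using assms unfolding subspace_vec_space_iff by blast
qed (use fin in \<open>auto intro: finite_PiE\<close>)

lemma card_subspace:
  assumes "VectorSpace.subspace F D (vec_space F n)"
  shows "card D = card (carrier F) ^ code_dim F n D"
proof -
  interpret V: vectorspace F "vec_space F n" by (rule vectorspace_vec_space)
  interpret W: vectorspace F "(vec_space F n)\<lparr>carrier := D\<rparr>"
    by (rule V.subspace_is_vs) (rule assms)
  show ?thesis
    using W.card_eq_power_dim fin finite_subspace[OF assms] by (simp add: code_dim_def)
qed

text \<open>As q = \<open>card (carrier F)\<close> exceeds 1, powers of q are strictly increasing,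
  so comparing cardinalities compares dimensions. All later dimension arguments about codes go
  through this instead of through bases.\<close>

lemma card_subspace_le_iff:
  assumes "VectorSpace.subspace F D (vec_space F n)"
  shows "card (carrier F) ^ r \<le> card D \<longleftrightarrow> r \<le> code_dim F n D"
    and "card D \<le> card (carrier F) ^ r \<longleftrightarrow> code_dim F n D \<le> r"
    and "card D = card (carrier F) ^ r \<longleftrightarrow> code_dim F n D = r"
  using card_carrier_gt_1 by (simp_all add: card_subspace[OF assms])

end

end

section \<open>Generalized Hamming weights and greedy weights\<close>

lemma finite_code_weights: "finite {code_wt F n D | D. P D}"
proof (rule finite_subset)
  show "{code_wt F n D | D. P D} \<subseteq> {..n}"
  proof clarsimp
    fix D
    have "card (code_supp F n D) \<le> card {1..n}"
      by (rule card_mono) (auto simp: code_supp_def)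
    then show "code_wt F n D \<le> n" by (simp add: code_wt_def)
  qed
qed simp

lemma gen_hamming_weight_le:
  assumes "subcode F n C D" and "r \<le> code_dim F n D"
  shows "gen_hamming_weight F n C r \<le> code_wt F n D"
  unfolding gen_hamming_weight_def
  by (rule Min_le[OF finite_code_weights]) (use assms in blast)

lemma gen_hamming_weight_eqI:
  assumes "subcode F n C D" and "r \<le> code_dim F n D"
    and "\<And>E. subcode F n C E \<Longrightarrow> r \<le> code_dim F n E \<Longrightarrow> code_wt F n D \<le> code_wt F n E"
  shows "gen_hamming_weight F n C r = code_wt F n D"
  unfolding gen_hamming_weight_def
  by (rule Min_eqI[OF finite_code_weights]) (use assms in blast)+

text \<open>By induction \<open>D (r - 1)\<close> is greedy and lies in \<open>D r\<close>, while
  \<open>D r\<close> has the least weight among all subcodes of dimension at least r. So the minimum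
  constrained by a greedy subcode coincides with the unconstrained one.\<close>

lemma chain_condition_imp_greedy_weight:
  fixes F :: "('a, 'b) ring_scheme"
  assumes F: "field F" "finite (carrier F)"
    and chain: "chain_condition F n C" and r: "r \<in> {1..code_dim F n C}"
  shows "greedy_weight F n C r = gen_hamming_weight F n C r"
proof -
  define q k where "q = card (carrier F)" and "k = code_dim F n C"
  obtain D where D0: "D 0 = {\<zero>\<^bsub>vec_space F n\<^esub>}" and Dk: "D k = C"
    and less: "\<And>r. r < k \<Longrightarrow> D r \<subset> D (Suc r)"
    and sub: "\<And>r. r \<in> {1..k} \<Longrightarrow> subcode F n C (D r)"
    and wt: "\<And>r. r \<in> {1..k} \<Longrightarrow> code_wt F n (D r) = gen_hamming_weight F n C r"
    using chain unfolding chain_condition_def k_def by blast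
  have k: "0 < k" using r by (simp add: k_def)
  have subsp: "VectorSpace.subspace F (D r) (vec_space F n)" if "r \<in> {1..k}" for r
    using sub[OF that] by (simp add: subcode_def)
  note card_iff = card_subspace_le_iff[OF F subsp, folded q_def]
  have card_less: "card (D r) < card (D (Suc r))" if "r < k" for r
    using less[OF that] that by (intro psubset_card_mono finite_subspace[OF F subsp]) auto
  \<comment> \<open>The chain condition leaves the dimensions of its members implicit; they are
    recovered from the strict inclusions. Climbing from \<open>D 0\<close>, each inclusion raises
    the dimension by at least one. Cardinalities let the induction start at 0, where
    \<open>subsp\<close> says nothing.\<close>
  have ge: "q ^ r \<le> card (D r)" if "r \<le> k" for r
    using that
  proof (induction r)
    case (Suc r)
    then have "q ^ r < card (D (Suc r))"
      using card_less[of r] by simp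
    then have "\<not> code_dim F n (D (Suc r)) \<le> r"
      using card_iff(2)[of "Suc r" r] Suc.prems by auto
    then show ?case
      using card_iff(1)[of "Suc r" "Suc r"] Suc.prems by auto
  qed (simp add: D0)
  \<comment> \<open>Conversely, descending from \<open>D k = C\<close> of dimension k, each strict
    inclusion lowers the dimension by at least one. The bound \<open>1 \<le> r\<close> keeps to the
    indices covered by \<open>subsp\<close>.\<close>
  have le: "code_dim F n (D r) \<le> r" if "r \<le> k" "1 \<le> r" for r
    using that
  proof (induction r rule: inc_induct)
    case base
    show ?case by (metis Dk k_def order_refl)
  next
    case (step r)
    then have "card (D r) < q ^ Suc r"
      using card_less[of r] card_iff(2)[of "Suc r" "Suc r"] by auto
    then show ?case
      using card_iff(1)[of r "Suc r"] step by auto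
  qed
  have dim: "code_dim F n (D r) = r" if "r \<in> {1..k}" for r
    using ge[of r] le[of r] card_iff(1)[of r r] that by auto
  \<comment> \<open>The second conjunct, on all greedy subcodes, supplies the uniqueness that the
    \<open>THE\<close> in \<open>greedy_weight\<close> requires.\<close>
  have greedy: "greedy_subcode F n C r (D r) \<and>
      (\<forall>E. greedy_subcode F n C r E \<longrightarrow> code_wt F n E = gen_hamming_weight F n C r)"
    if "r \<in> {1..k}" for r
    using that
  proof (induction r)
    case (Suc r)
    show ?case
    proof (cases r)
      case 0
      then show ?thesis
        using sub[of 1] dim[of 1] wt[of 1] k by auto
    next
      case (Suc s)
      define P where "P = (\<lambda>E. subcode F n C E \<and> code_dim F n E = Suc r \<and>
          (\<exists>E'. greedy_subcode F n C r E' \<and> E' \<subseteq> E))"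
      have P: "P (D (Suc r))"
        unfolding P_def using Suc.IH Suc.prems Suc sub dim less[of r] by auto
      \<comment> \<open>Every competitor has dimension \<open>Suc r\<close>, so its weight is at
        least the generalized Hamming weight, which \<open>D (Suc r)\<close> attains.\<close>
      have min: "code_wt F n (D (Suc r)) \<le> code_wt F n E" if "P E" for E
        using that wt[OF Suc.prems] gen_hamming_weight_le[of F n C E "Suc r"] by (simp add: P_def)
      have iff: "greedy_subcode F n C (Suc r) E \<longleftrightarrow> is_arg_min (code_wt F n) P E" for E
        by (simp add: Suc P_def)
      show ?thesis
        using P min wt[OF Suc.prems] unfolding iff is_arg_min_linorder
        by (metis le_antisym)
    qed
  qed simp
  show ?thesis
    unfolding greedy_weight_def using greedy[of r] r k_def by (intro the_equality) auto
qed


section \<open>Polynomials with prescribed roots\<close>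

context UP_domain
begin

lemma evalRR_smult:
  assumes "a \<in> carrier R" and "p \<in> carrier P" and "x \<in> carrier R"
  shows "eval R R id x (a \<odot>\<^bsub>P\<^esub> p) = a \<otimes> eval R R id x p"
  using assms by (simp add: monom_mult_is_smult[symmetric] evalRR_simps)

text \<open>The product of the linear factors X - a over the a in \<open>A\<close>. Each factor
  raises the degree by one, and the absence of zero divisors prevents further roots.\<close>

lemma exists_poly_with_roots:
  assumes "finite A" and "A \<subseteq> carrier R"
  shows "\<exists>p\<in>carrier P. p \<noteq> \<zero>\<^bsub>P\<^esub> \<and> deg R p = card A \<and>
           (\<forall>x\<in>carrier R. eval R R id x p = \<zero> \<longleftrightarrow> x \<in> A)"
  using assms
proof (induction A)
  case empty
  have "eval R R id x \<one>\<^bsub>P\<^esub> \<noteq> \<zero>" if "x \<in> carrier R" for x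
    using evalRR_one[OF that] R.one_not_zero by metis
  then show ?case
    by (intro bexI[of _ "\<one>\<^bsub>P\<^esub>"] conjI) (simp, simp, blast, simp)
next
  case (insert a A)
  then obtain p where p: "p \<in> carrier P" "p \<noteq> \<zero>\<^bsub>P\<^esub>" "deg R p = card A"
    and roots: "\<And>x. x \<in> carrier R \<Longrightarrow> eval R R id x p = \<zero> \<longleftrightarrow> x \<in> A"
    by (metis insert_subset)
  have a: "a \<in> carrier R" using insert.prems by simp
  define l where "l = monom P \<one> 1 \<ominus>\<^bsub>P\<^esub> monom P a 0"
  have l: "l \<in> carrier P" using a by (simp add: l_def)
  have deg_l: "deg R l = 1"
    using a by (simp add: l_def deg_minus_eq)
  then have "l \<noteq> \<zero>\<^bsub>P\<^esub>" by auto
  then have "l \<otimes>\<^bsub>P\<^esub> p \<noteq> \<zero>\<^bsub>P\<^esub>" "deg R (l \<otimes>\<^bsub>P\<^esub> p) = card (insert a A)"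
    using p l deg_l insert.hyps by (simp_all add: integral_iff)
  moreover have "eval R R id x (l \<otimes>\<^bsub>P\<^esub> p) = \<zero> \<longleftrightarrow> x \<in> insert a A" if x: "x \<in> carrier R" for x
  proof -
    have "eval R R id x l = x \<ominus> a"
      using a x by (simp add: l_def evalRR_simps)
    then have "eval R R id x (l \<otimes>\<^bsub>P\<^esub> p) = \<zero> \<longleftrightarrow> x = a \<or> eval R R id x p = \<zero>"
      using l p(1) a x by (simp add: evalRR_mult carrier_evalRR R.integral_iff)
    then show ?thesis using roots[OF x] by simp
  qed
  ultimately show ?case
    using l p(1) P.m_closed by blast
qed

text \<open>The linear span of \<open>p 1\<close>, ..., \<open>p r\<close>, built one generator at a
  time so that closure, degrees and cardinality can be treated by induction on r.\<close>

primrec span_upto :: "(nat \<Rightarrow> nat \<Rightarrow> 'a) \<Rightarrow> nat \<Rightarrow> (nat \<Rightarrow> 'a) set" where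
  "span_upto p 0 = {\<zero>\<^bsub>P\<^esub>}"
| "span_upto p (Suc r) = {a \<odot>\<^bsub>P\<^esub> p (Suc r) \<oplus>\<^bsub>P\<^esub> f | a f. a \<in> carrier R \<and> f \<in> span_upto p r}"

end

section \<open>Spans of polynomials of pairwise distinct degrees\<close>

locale distinct_degrees = UP_domain R P for R (structure) and P (structure) +
  fixes p :: "nat \<Rightarrow> nat \<Rightarrow> 'a" and k :: nat
  assumes p_closed: "s \<in> {1..k} \<Longrightarrow> p s \<in> carrier P"
    and p_nonzero: "s \<in> {1..k} \<Longrightarrow> p s \<noteq> \<zero>\<^bsub>P\<^esub>"
    and inj_deg: "inj_on (\<lambda>s. deg R (p s)) {1..k}"
begin

lemma span_upto_closed: "r \<le> k \<Longrightarrow> span_upto p r \<subseteq> carrier P"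
  using p_closed by (induction r) auto

lemma zero_in_span_upto: "r \<le> k \<Longrightarrow> \<zero>\<^bsub>P\<^esub> \<in> span_upto p r"
proof (induction r)
  case (Suc r)
  then have "\<zero>\<^bsub>P\<^esub> = \<zero> \<odot>\<^bsub>P\<^esub> p (Suc r) \<oplus>\<^bsub>P\<^esub> \<zero>\<^bsub>P\<^esub>"
    using p_closed[of "Suc r"] by simp
  then show ?case
    using Suc by fastforce
qed simp

lemma span_upto_mono: "Suc r \<le> k \<Longrightarrow> span_upto p r \<subseteq> span_upto p (Suc r)"
proof
  fix f assume r: "Suc r \<le> k" and f: "f \<in> span_upto p r"
  then have "f = \<zero> \<odot>\<^bsub>P\<^esub> p (Suc r) \<oplus>\<^bsub>P\<^esub> f"
    using p_closed[of "Suc r"] span_upto_closed[of r] by auto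
  then show "f \<in> span_upto p (Suc r)"
    using f by fastforce
qed

lemma generator_in_span_upto: "r \<in> {1..k} \<Longrightarrow> p r \<in> span_upto p r"
proof (cases r)
  case (Suc s)
  assume r: "r \<in> {1..k}"
  then have "p r = \<one> \<odot>\<^bsub>P\<^esub> p (Suc s) \<oplus>\<^bsub>P\<^esub> \<zero>\<^bsub>P\<^esub>"
    using p_closed[of r] Suc by simp
  then show ?thesis
    using r Suc zero_in_span_upto[of s] by fastforce
qed simp

lemma span_upto_add:
  "r \<le> k \<Longrightarrow> f \<in> span_upto p r \<Longrightarrow> g \<in> span_upto p r \<Longrightarrow> f \<oplus>\<^bsub>P\<^esub> g \<in> span_upto p r"
proof (induction r arbitrary: f g)
  case (Suc r)
  then obtain a b f' g' where ab: "a \<in> carrier R" "b \<in> carrier R"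
    and f'g': "f' \<in> span_upto p r" "g' \<in> span_upto p r"
    and f: "f = a \<odot>\<^bsub>P\<^esub> p (Suc r) \<oplus>\<^bsub>P\<^esub> f'" and g: "g = b \<odot>\<^bsub>P\<^esub> p (Suc r) \<oplus>\<^bsub>P\<^esub> g'"
    by auto
  have "f \<oplus>\<^bsub>P\<^esub> g = (a \<oplus> b) \<odot>\<^bsub>P\<^esub> p (Suc r) \<oplus>\<^bsub>P\<^esub> (f' \<oplus>\<^bsub>P\<^esub> g')"
    using ab f'g' p_closed[of "Suc r"] Suc.prems(1) span_upto_closed[of r]
    by (simp add: f g smult_l_distr subset_iff P.a_ac)
  then show ?case
    using ab Suc.IH[OF _ f'g'] Suc.prems(1) by fastforce
qed simp

lemma span_upto_smult:
  "r \<le> k \<Longrightarrow> c \<in> carrier R \<Longrightarrow> f \<in> span_upto p r \<Longrightarrow> c \<odot>\<^bsub>P\<^esub> f \<in> span_upto p r"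
proof (induction r arbitrary: f)
  case (Suc r)
  then obtain a f' where a: "a \<in> carrier R" and f': "f' \<in> span_upto p r"
    and f: "f = a \<odot>\<^bsub>P\<^esub> p (Suc r) \<oplus>\<^bsub>P\<^esub> f'"
    by auto
  have "c \<odot>\<^bsub>P\<^esub> f = (c \<otimes> a) \<odot>\<^bsub>P\<^esub> p (Suc r) \<oplus>\<^bsub>P\<^esub> c \<odot>\<^bsub>P\<^esub> f'"
    using a f' p_closed[of "Suc r"] Suc.prems span_upto_closed[of r]
    by (simp add: f smult_r_distr smult_assoc1 subset_iff)
  then show ?case
    using a Suc.IH[OF _ _ f'] Suc.prems by fastforce
qed simp

text \<open>Reduces differences to the two operations under which spans and codes are
  closed.\<close>

lemma minus_eq_add_smult:
  assumes "f \<in> carrier P" and "g \<in> carrier P"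
  shows "f \<ominus>\<^bsub>P\<^esub> g = f \<oplus>\<^bsub>P\<^esub> (\<ominus> \<one>) \<odot>\<^bsub>P\<^esub> g"
  using assms by (simp add: P.minus_eq smult_l_minus)

lemma span_upto_minus:
  assumes "r \<le> k" and "f \<in> span_upto p r" and "g \<in> span_upto p r"
  shows "f \<ominus>\<^bsub>P\<^esub> g \<in> span_upto p r"
  using assms span_upto_closed[OF assms(1)] span_upto_add span_upto_smult
  by (subst minus_eq_add_smult) auto

text \<open>Leading terms of distinct degrees cannot cancel, so the degree of a nonzero combination
  is the largest degree among the generators that occur with nonzero coefficient.\<close>

lemma deg_span_upto:
  "r \<le> k \<Longrightarrow> f \<in> span_upto p r \<Longrightarrow> f \<noteq> \<zero>\<^bsub>P\<^esub> \<Longrightarrow> deg R f \<in> (\<lambda>s. deg R (p s)) ` {1..r}"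
proof (induction r arbitrary: f)
  case (Suc r)
  then obtain a f' where a: "a \<in> carrier R" and f': "f' \<in> span_upto p r"
    and f: "f = a \<odot>\<^bsub>P\<^esub> p (Suc r) \<oplus>\<^bsub>P\<^esub> f'"
    by auto
  have p: "p (Suc r) \<in> carrier P" using p_closed Suc.prems by simp
  have f'P: "f' \<in> carrier P" using f' span_upto_closed[of r] Suc.prems by auto
  have ins: "{1..Suc r} = insert (Suc r) {1..r}" by auto
  show ?case
  proof (cases "a = \<zero>")
    case True
    then have "f = f'" using f p f'P by simp
    then show ?thesis using Suc f' ins by auto
  next
    case False
    then have deg: "deg R (a \<odot>\<^bsub>P\<^esub> p (Suc r)) = deg R (p (Suc r))"
      using a p by simp
    show ?thesis
    proof (cases "f' = \<zero>\<^bsub>P\<^esub>")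
      case True
      then show ?thesis using f a p deg ins by simp
    next
      case f'0: False
      then have f'deg: "deg R f' \<in> (\<lambda>s. deg R (p s)) ` {1..r}"
        using Suc.IH[OF _ f'] Suc.prems by simp
      moreover have "deg R (p (Suc r)) \<notin> (\<lambda>s. deg R (p s)) ` {1..r}"
        using Suc.prems(1) inj_onD[OF inj_deg, of "Suc r"] by fastforce
      ultimately have "deg R f' \<noteq> deg R (p (Suc r))" by metis
      \<comment> \<open>The generators are not sorted by degree, so either summand may
        dominate.\<close>
      then have "deg R f = max (deg R (p (Suc r))) (deg R f')"
        using deg_add_eq[of "a \<odot>\<^bsub>P\<^esub> p (Suc r)" f'] f a p f'P deg by simp
      then show ?thesis using f'deg ins by (auto simp: max_def)
    qed
  qed
qed simp

text \<open>Linear independence in counting form. Two representations with different leading scalars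
  would place a nonzero multiple of \<open>p (Suc r)\<close> in the span of the earlier generators,
  where by \<open>deg_span_upto\<close> its degree does not occur.\<close>

lemma card_span_upto:
  assumes "finite (carrier R)"
  shows "r \<le> k \<Longrightarrow> card (span_upto p r) = card (carrier R) ^ r"
proof (induction r)
  case (Suc r)
  let ?h = "\<lambda>(a, f). a \<odot>\<^bsub>P\<^esub> p (Suc r) \<oplus>\<^bsub>P\<^esub> f"
  have p: "p (Suc r) \<in> carrier P" "p (Suc r) \<noteq> \<zero>\<^bsub>P\<^esub>"
    using p_closed p_nonzero Suc.prems by simp_all
  have sub: "span_upto p r \<subseteq> carrier P" using span_upto_closed Suc.prems by simp
  have "inj_on ?h (carrier R \<times> span_upto p r)"
  proof (rule inj_onI, clarify)
    fix a b f g
    assume ab: "a \<in> carrier R" "b \<in> carrier R"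
      and fg: "f \<in> span_upto p r" "g \<in> span_upto p r"
      and eq: "a \<odot>\<^bsub>P\<^esub> p (Suc r) \<oplus>\<^bsub>P\<^esub> f = b \<odot>\<^bsub>P\<^esub> p (Suc r) \<oplus>\<^bsub>P\<^esub> g"
    have fgP: "f \<in> carrier P" "g \<in> carrier P" using fg sub by auto
    have "(a \<ominus> b) \<odot>\<^bsub>P\<^esub> p (Suc r) = a \<odot>\<^bsub>P\<^esub> p (Suc r) \<ominus>\<^bsub>P\<^esub> b \<odot>\<^bsub>P\<^esub> p (Suc r)"
      using ab p by (simp add: R.minus_eq P.minus_eq smult_l_distr smult_l_minus)
    also have "\<dots> = g \<ominus>\<^bsub>P\<^esub> f"
    proof -
      have cancel: "u = (u \<oplus>\<^bsub>P\<^esub> f) \<ominus>\<^bsub>P\<^esub> f" if "u \<in> carrier P" for u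
        using that fgP by (simp add: P.minus_eq P.a_assoc P.r_neg)
      have "a \<odot>\<^bsub>P\<^esub> p (Suc r) = (b \<odot>\<^bsub>P\<^esub> p (Suc r) \<oplus>\<^bsub>P\<^esub> g) \<ominus>\<^bsub>P\<^esub> f"
        using cancel[of "a \<odot>\<^bsub>P\<^esub> p (Suc r)"] eq ab p by simp
      then show ?thesis
        using ab p fgP by (simp add: P.minus_eq P.a_ac P.r_neg)
    qed
    finally have "(a \<ominus> b) \<odot>\<^bsub>P\<^esub> p (Suc r) \<in> span_upto p r"
      using span_upto_minus fg Suc.prems by simp
    moreover have "deg R (p (Suc r)) \<notin> (\<lambda>s. deg R (p s)) ` {1..r}"
      using Suc.prems(1) inj_onD[OF inj_deg, of "Suc r"] by fastforce
    moreover have "(a \<ominus> b) \<odot>\<^bsub>P\<^esub> p (Suc r) \<noteq> \<zero>\<^bsub>P\<^esub>" if "a \<noteq> b"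
    proof -
      have "coeff P ((a \<ominus> b) \<odot>\<^bsub>P\<^esub> p (Suc r)) (deg R (p (Suc r))) \<noteq> \<zero>"
        using that ab p lcoeff_nonzero[of "p (Suc r)"] by (simp add: R.integral_iff)
      then show ?thesis by (metis coeff_zero)
    qed
    ultimately have "a = b"
      using deg_span_upto[of r "(a \<ominus> b) \<odot>\<^bsub>P\<^esub> p (Suc r)"] ab p Suc.prems
      by (auto split: if_splits)
    then show "a = b \<and> f = g"
      using eq ab p fgP by simp
  qed
  moreover have "span_upto p (Suc r) = ?h ` (carrier R \<times> span_upto p r)"
    by auto
  ultimately show ?case
    using Suc by (simp add: card_image card_cartesian_product)
qed simp

end

section \<open>The evaluation code and its weights\<close>

locale weight_code = UP_domain R P + field R for R (structure) and P (structure) +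
  fixes n k :: nat and d :: "nat \<Rightarrow> nat" and \<alpha> :: "nat \<Rightarrow> 'a" and p :: "nat \<Rightarrow> nat \<Rightarrow> 'a"
  assumes finite_R: "finite (carrier R)"
    and k_pos: "1 \<le> k" and d_mono: "strict_mono_on {1..k} d"
    and d_pos: "s \<in> {1..k} \<Longrightarrow> 0 < d s" and d_le: "d k \<le> n"
    and \<alpha>_closed: "i \<in> {1..n} \<Longrightarrow> \<alpha> i \<in> carrier R" and inj_\<alpha>: "inj_on \<alpha> {1..n}"
    and gen_closed: "s \<in> {1..k} \<Longrightarrow> p s \<in> carrier P"
    and gen_nonzero: "s \<in> {1..k} \<Longrightarrow> p s \<noteq> \<zero>\<^bsub>P\<^esub>"
    and deg_gen: "s \<in> {1..k} \<Longrightarrow> deg R (p s) = n - d s"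
    and gen_root_iff: "s \<in> {1..k} \<Longrightarrow> i \<in> {1..n} \<Longrightarrow> eval R R id (\<alpha> i) (p s) = \<zero> \<longleftrightarrow> d s < i"
begin

lemma d_less: "r \<in> {1..k} \<Longrightarrow> s \<in> {1..k} \<Longrightarrow> r < s \<Longrightarrow> d r < d s"
  using d_mono by (simp add: strict_mono_on_def)

lemma d_le_iff: "r \<in> {1..k} \<Longrightarrow> s \<in> {1..k} \<Longrightarrow> d r \<le> d s \<longleftrightarrow> r \<le> s"
  using d_less[of r s] d_less[of s r] by (cases r s rule: linorder_cases) auto

text \<open>Keeps the subtraction in \<open>n - d s\<close> from truncating, so that distinct
  weights give distinct degrees.\<close>

lemma d_le_n: "s \<in> {1..k} \<Longrightarrow> d s \<le> n"
  using d_le_iff[of s k] k_pos d_le by simp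

sublocale distinct_degrees R P p k
proof unfold_locales
  show "inj_on (\<lambda>s. deg R (p s)) {1..k}"
  proof (rule inj_onI)
    fix r s assume rs: "r \<in> {1..k}" "s \<in> {1..k}" "deg R (p r) = deg R (p s)"
    then have "d r = d s"
      using deg_gen d_le_n[of r] d_le_n[of s] by simp
    then show "r = s"
      using rs d_le_iff[of r s] d_le_iff[of s r] by simp
  qed
qed (use gen_closed gen_nonzero in \<open>auto simp: P_def\<close>)

definition evals :: "(nat \<Rightarrow> 'a) \<Rightarrow> nat \<Rightarrow> 'a" where
  "evals f = (\<lambda>i\<in>{1..n}. eval R R id (\<alpha> i) f)"

text \<open>\<open>codes k\<close> is the code sought, and the \<open>codes r\<close> with
  \<open>r < k\<close> are the lower members of its chain.\<close>

definition codes :: "nat \<Rightarrow> (nat \<Rightarrow> 'a) set" where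
  "codes r = evals ` span_upto p r"

lemma evals_add:
  "f \<in> carrier P \<Longrightarrow> g \<in> carrier P \<Longrightarrow> evals (f \<oplus>\<^bsub>P\<^esub> g) = (\<lambda>i\<in>{1..n}. evals f i \<oplus> evals g i)"
  using \<alpha>_closed by (auto simp: evals_def evalRR_add intro!: restrict_ext)

lemma evals_smult:
  "c \<in> carrier R \<Longrightarrow> f \<in> carrier P \<Longrightarrow> evals (c \<odot>\<^bsub>P\<^esub> f) = (\<lambda>i\<in>{1..n}. c \<otimes> evals f i)"
  using \<alpha>_closed by (auto simp: evals_def evalRR_smult intro!: restrict_ext)

lemma evals_closed: "f \<in> carrier P \<Longrightarrow> evals f \<in> {1..n} \<rightarrow>\<^sub>E carrier R"
  using \<alpha>_closed by (auto simp: evals_def carrier_evalRR)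

lemma evals_zero: "evals \<zero>\<^bsub>P\<^esub> = (\<lambda>i\<in>{1..n}. \<zero>)"
proof -
  have "evals (\<zero> \<odot>\<^bsub>P\<^esub> \<zero>\<^bsub>P\<^esub>) = (\<lambda>i\<in>{1..n}. \<zero> \<otimes> evals \<zero>\<^bsub>P\<^esub> i)"
    by (rule evals_smult) auto
  also have "\<dots> = (\<lambda>i\<in>{1..n}. \<zero>)"
    using PiE_mem[OF evals_closed[OF P.zero_closed]] by (intro restrict_ext R.l_null) blast
  finally show ?thesis by simp
qed

text \<open>The Reed-Solomon bound: as the points \<open>\<alpha> i\<close> are distinct, the zero
  positions of the codeword inject into the roots of \<open>f\<close>, of which there are at most
  \<open>deg R f\<close>.\<close>

lemma card_support_evals:
  assumes "f \<in> carrier P" and "f \<noteq> \<zero>\<^bsub>P\<^esub>"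
  shows "n - deg R f \<le> card {i \<in> {1..n}. evals f i \<noteq> \<zero>}"
proof -
  let ?Z = "{i \<in> {1..n}. evals f i = \<zero>}" and ?N = "{i \<in> {1..n}. evals f i \<noteq> \<zero>}"
  have "card ?Z = card (\<alpha> ` ?Z)"
    by (rule card_image[symmetric], rule inj_on_subset[OF inj_\<alpha>]) auto
  also have "\<dots> \<le> card {a \<in> carrier R. eval R R id a f = \<zero>}"
    using \<alpha>_closed finite_R by (intro card_mono) (auto simp: evals_def)
  also have "\<dots> \<le> deg R f"
    using roots_bound[OF assms finite_R] by simp
  finally have "card ?Z \<le> deg R f" .
  moreover have "card ?Z + card ?N = n"
  proof -
    have "card (?Z \<union> ?N) = card ?Z + card ?N"
      by (rule card_Un_disjoint) auto
    moreover have "?Z \<union> ?N = {1..n}" by auto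
    ultimately show ?thesis by simp
  qed
  ultimately show ?thesis by simp
qed

text \<open>A nonzero difference has some degree \<open>n - d s\<close>, which is less than n
  because \<open>0 < d s \<le> n\<close>; it cannot vanish at n distinct points.\<close>

lemma inj_on_evals: "inj_on evals (span_upto p k)"
proof (rule inj_onI, rule ccontr)
  fix f g assume fg: "f \<in> span_upto p k" "g \<in> span_upto p k" "evals f = evals g" "f \<noteq> g"
  have fgP: "f \<in> carrier P" "g \<in> carrier P" using fg span_upto_closed by auto
  let ?h = "f \<ominus>\<^bsub>P\<^esub> g"
  have h0: "?h \<noteq> \<zero>\<^bsub>P\<^esub>" using fg fgP by simp
  have h: "?h \<in> span_upto p k" using span_upto_minus fg by simp
  then obtain s where s: "s \<in> {1..k}" "deg R ?h = n - d s"
    using deg_span_upto[OF _ h h0] deg_gen by auto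
  have "evals ?h i = \<zero>" if "i \<in> {1..n}" for i
  proof -
    have "eval R R id (\<alpha> i) f = eval R R id (\<alpha> i) g"
      using fun_cong[OF fg(3), of i] unfolding evals_def restrict_apply'[OF that] .
    then show ?thesis
      using that fgP \<alpha>_closed by (simp add: evals_def evalRR_sub carrier_evalRR)
  qed
  then have empty: "{i \<in> {1..n}. evals ?h i \<noteq> \<zero>} = {}" by blast
  have "n - deg R ?h = 0"
    using card_support_evals[of ?h] h0 fgP unfolding empty by simp
  then show False
    using s d_le_n[of s] d_pos[of s] by simp
qed

lemma span_upto_le: "r \<le> s \<Longrightarrow> s \<le> k \<Longrightarrow> span_upto p r \<subseteq> span_upto p s"
proof (induction s rule: dec_induct)
  case (step s)
  then show ?case using span_upto_mono[of s] by simp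
qed simp

lemma codes_mono: "r \<le> s \<Longrightarrow> s \<le> k \<Longrightarrow> codes r \<subseteq> codes s"
  using span_upto_le by (auto simp: codes_def)

lemma card_codes:
  assumes "r \<le> k"
  shows "card (codes r) = card (carrier R) ^ r"
proof -
  have "inj_on evals (span_upto p r)"
    by (rule inj_on_subset[OF inj_on_evals span_upto_le[OF assms order_refl]])
  then show ?thesis
    unfolding codes_def by (simp add: card_image card_span_upto finite_R assms)
qed

lemma subspace_codes:
  assumes "r \<le> k"
  shows "VectorSpace.subspace R (codes r) (vec_space R n)"
proof -
  note sub = span_upto_closed[OF assms]
  have "codes r \<subseteq> {1..n} \<rightarrow>\<^sub>E carrier R"
    using sub evals_closed by (auto simp: codes_def)
  moreover have "(\<lambda>i\<in>{1..n}. \<zero>) \<in> codes r"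
    unfolding codes_def evals_zero[symmetric] using zero_in_span_upto[OF assms] by blast
  moreover have "(\<lambda>i\<in>{1..n}. v i \<oplus> w i) \<in> codes r" if vw: "v \<in> codes r" "w \<in> codes r" for v w
  proof -
    obtain f g where fg: "f \<in> span_upto p r" "g \<in> span_upto p r" "v = evals f" "w = evals g"
      using vw by (auto simp: codes_def)
    then have "f \<in> carrier P" "g \<in> carrier P" using sub by auto
    then have "(\<lambda>i\<in>{1..n}. v i \<oplus> w i) = evals (f \<oplus>\<^bsub>P\<^esub> g)"
      by (simp add: fg evals_add)
    then show ?thesis
      using span_upto_add[OF assms fg(1,2)] by (simp add: codes_def)
  qed
  moreover have "(\<lambda>i\<in>{1..n}. c \<otimes> v i) \<in> codes r" if cv: "c \<in> carrier R" "v \<in> codes r" for c v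
  proof -
    obtain f where f: "f \<in> span_upto p r" "v = evals f"
      using cv by (auto simp: codes_def)
    then have "f \<in> carrier P" using sub by auto
    then have "(\<lambda>i\<in>{1..n}. c \<otimes> v i) = evals (c \<odot>\<^bsub>P\<^esub> f)"
      using cv(1) by (simp add: f evals_smult)
    then show ?thesis
      using span_upto_smult[OF assms cv(1) f(1)] by (simp add: codes_def)
  qed
  ultimately show ?thesis
    unfolding subspace_vec_space_iff[OF field_axioms] by blast
qed

lemma code_dim_codes: "r \<le> k \<Longrightarrow> code_dim R n (codes r) = r"
  using card_subspace_le_iff(3)[OF field_axioms finite_R subspace_codes, of r r] card_codes[of r]
  by blast

lemma subcode_codes: "r \<le> k \<Longrightarrow> subcode R n (codes k) (codes r)"
  using subspace_codes codes_mono by (simp add: subcode_def)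

text \<open>For \<open>s \<le> r\<close> one has \<open>d s \<le> d r < i\<close>, so
  \<open>\<alpha> i\<close> is a common root of all generators involved and hence of their
  combinations.\<close>

lemma evals_eq_zero:
  assumes "r \<in> {1..k}" and "f \<in> span_upto p r" and i: "i \<in> {1..n}" "d r < i"
  shows "evals f i = \<zero>"
proof -
  have "eval R R id (\<alpha> i) f = \<zero>" if "s \<le> r" "f \<in> span_upto p s" for s f
    using that
  proof (induction s arbitrary: f)
    case 0
    have "evals \<zero>\<^bsub>P\<^esub> i = \<zero>"
      using i by (simp add: evals_zero)
    then show ?case
      using 0 i(1) unfolding evals_def by (metis restrict_apply' singletonD span_upto.simps(1))
  next
    case (Suc s)
    then obtain a g where a: "a \<in> carrier R" and g: "g \<in> span_upto p s"
      and f: "f = a \<odot>\<^bsub>P\<^esub> p (Suc s) \<oplus>\<^bsub>P\<^esub> g"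
      by auto
    have s: "Suc s \<in> {1..k}" using assms(1) Suc.prems by auto
    then have "d (Suc s) < i"
      using d_le_iff[of "Suc s" r] assms(1) Suc.prems i by simp
    then have "eval R R id (\<alpha> i) (p (Suc s)) = \<zero>"
      using gen_root_iff[OF s i(1)] by simp
    moreover have "eval R R id (\<alpha> i) g = \<zero>"
      by (rule Suc.IH[OF Suc_leD[OF Suc.prems(1)] g])
    moreover have gP: "g \<in> carrier P" using g span_upto_closed[of s] s by auto
    have "eval R R id (\<alpha> i) f = a \<otimes> eval R R id (\<alpha> i) (p (Suc s)) \<oplus> eval R R id (\<alpha> i) g"
      using a gP gen_closed[OF s] \<alpha>_closed[OF i(1)]
      by (simp only: f evalRR_add evalRR_smult smult_closed)
    ultimately show ?case
      using a by (simp only: R.r_null R.l_zero R.zero_closed)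
  qed
  then show ?thesis
    using assms(2) unfolding evals_def restrict_apply'[OF i(1)] by blast
qed

text \<open>Positions above \<open>d r\<close> are excluded by \<open>evals_eq_zero\<close>. The
  single codeword of \<open>p r\<close> already covers all others, since its zeros are exactly the
  positions above \<open>d r\<close>.\<close>

lemma code_wt_codes:
  assumes r: "r \<in> {1..k}"
  shows "code_wt R n (codes r) = d r"
proof -
  have "code_supp R n (codes r) = {1..d r}"
  proof (intro equalityI subsetI)
    fix i assume "i \<in> code_supp R n (codes r)"
    then show "i \<in> {1..d r}"
      using evals_eq_zero[OF r] by (force simp: code_supp_def codes_def)
  next
    fix i assume i: "i \<in> {1..d r}"
    then have "i \<in> {1..n}" using d_le_n[OF r] by simp
    moreover from this have "evals (p r) i \<noteq> \<zero>"
      using gen_root_iff[OF r] i by (simp add: evals_def)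
    ultimately show "i \<in> code_supp R n (codes r)"
      using generator_in_span_upto[OF r] by (auto simp: code_supp_def codes_def)
  qed
  then show ?thesis by (simp add: code_wt_def)
qed

text \<open>Two elements of \<open>D\<close> agree in the coefficients at the first \<open>r - 1\<close> of the degrees
  \<open>n - d s\<close>, because \<open>D\<close> has at least \<open>q ^ r\<close> elements. Their difference has degree at most
  \<open>n - d r\<close>, hence at most that many zeros.\<close>

lemma code_wt_ge:
  assumes r: "r \<in> {1..k}" and D: "subcode R n (codes k) D" "r \<le> code_dim R n D"
  shows "d r \<le> code_wt R n D"
proof -
  define S where "S = {f \<in> span_upto p k. evals f \<in> D}"
  define c where "c = (\<lambda>f. \<lambda>s\<in>{1..<r}. coeff P f (deg R (p s)))"
  have sub: "VectorSpace.subspace R D (vec_space R n)" "D \<subseteq> codes k"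
    using D by (auto simp: subcode_def)
  have SP: "S \<subseteq> carrier P" using span_upto_closed by (auto simp: S_def)
  \<comment> \<open>Evaluation is injective on the span, so counting codewords in \<open>D\<close>
    is counting polynomials in \<open>S\<close>.\<close>
  have "D = evals ` S" using sub(2) by (auto simp: S_def codes_def)
  then have "card D = card S"
    using card_image[of evals S] inj_on_subset[OF inj_on_evals, of S] by (auto simp: S_def)
  then have card_S: "card (carrier R) ^ r \<le> card S"
    using card_subspace_le_iff(1)[OF field_axioms finite_R sub(1)] D(2) by simp
  \<comment> \<open>The map \<open>c\<close> takes at most q ^ (r - 1) values, with q the size of
    the field, too few to be injective on \<open>S\<close>.\<close>
  have "card ({1..<r} \<rightarrow>\<^sub>E carrier R) = card (carrier R) ^ (r - 1)"
    by (simp add: card_PiE)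
  also have "\<dots> < card (carrier R) ^ r"
    using card_carrier_gt_1[OF field_axioms finite_R] r by (intro power_strict_increasing) auto
  finally have "card ({1..<r} \<rightarrow>\<^sub>E carrier R) < card S" using card_S by simp
  moreover have "c ` S \<subseteq> {1..<r} \<rightarrow>\<^sub>E carrier R"
    using SP by (auto simp: c_def)
  then have "card (c ` S) \<le> card ({1..<r} \<rightarrow>\<^sub>E carrier R)"
    using finite_R by (intro card_mono) (auto intro: finite_PiE)
  ultimately have "\<not> inj_on c S"
    using pigeonhole[of c S] by simp
  then obtain f g where fg: "f \<in> S" "g \<in> S" "f \<noteq> g" "c f = c g"
    unfolding inj_on_def by blast
  then have fgP: "f \<in> carrier P" "g \<in> carrier P" using SP by auto
  let ?h = "f \<ominus>\<^bsub>P\<^esub> g"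
  have hP: "?h \<in> carrier P" and h0: "?h \<noteq> \<zero>\<^bsub>P\<^esub>" using fg fgP by simp_all
  have h: "?h \<in> span_upto p k" using span_upto_minus fg by (simp add: S_def)
  then obtain s where s: "s \<in> {1..k}" "deg R ?h = deg R (p s)"
    using deg_span_upto[OF order_refl h h0] by auto
  have "r \<le> s"
  proof (rule ccontr)
    assume "\<not> r \<le> s"
    then have "s \<in> {1..<r}" using s(1) by simp
    then have "coeff P f (deg R (p s)) = coeff P g (deg R (p s))"
      using fun_cong[OF fg(4), of s] by (simp add: c_def)
    \<comment> \<open>For \<open>s < r\<close> the coefficients agreeing under \<open>c\<close>
      would include the leading one of the difference.\<close>
    then have "coeff P ?h (deg R ?h) = \<zero>"
      using fgP s(2) by simp
    then show False
      using lcoeff_nonzero[OF h0 hP] by simp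
  qed
  \<comment> \<open>Here \<open>n - deg R ?h = n - (n - d s) = d s\<close>, and
    \<open>d r \<le> d s\<close>.\<close>
  then have "d r \<le> n - deg R ?h"
    using s d_le_iff[OF r s(1)] deg_gen[OF s(1)] d_le_n[OF s(1)] by simp
  also have "\<dots> \<le> card {i \<in> {1..n}. evals ?h i \<noteq> \<zero>}"
    using card_support_evals[OF hP h0] .
  also have "\<dots> \<le> code_wt R n D"
  proof -
    \<comment> \<open>Subspaces are described by sums and scalar multiples, so the difference enters
      \<open>D\<close> through the scalar -1.\<close>
    have "evals ((\<ominus> \<one>) \<odot>\<^bsub>P\<^esub> g) \<in> D"
      using fg fgP sub(1) unfolding subspace_vec_space_iff[OF field_axioms]
      by (simp add: evals_smult S_def)
    then have "evals ?h \<in> D"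
      using fg fgP sub(1) unfolding subspace_vec_space_iff[OF field_axioms]
      by (simp add: minus_eq_add_smult evals_add S_def)
    then show ?thesis
      unfolding code_wt_def by (intro card_mono) (auto simp: code_supp_def)
  qed
  finally show ?thesis .
qed

lemma gen_hamming_weight_codes:
  assumes r: "r \<in> {1..k}"
  shows "gen_hamming_weight R n (codes k) r = d r"
proof -
  have "gen_hamming_weight R n (codes k) r = code_wt R n (codes r)"
  proof (rule gen_hamming_weight_eqI)
    show "subcode R n (codes k) (codes r)" "r \<le> code_dim R n (codes r)"
      using r subcode_codes code_dim_codes by simp_all
    show "code_wt R n (codes r) \<le> code_wt R n E"
      if "subcode R n (codes k) E" "r \<le> code_dim R n E" for E
      using code_wt_ge[OF r that] by (simp only: code_wt_codes[OF r])
  qed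
  then show ?thesis using code_wt_codes[OF r] by simp
qed

lemma chain_condition_codes: "chain_condition R n (codes k)"
proof -
  have zero: "codes 0 = {\<zero>\<^bsub>vec_space R n\<^esub>}"
    unfolding codes_def span_upto.simps image_insert image_empty evals_zero
      zero_vec_space[OF field_axioms] ..
  have less: "codes r \<subset> codes s" if rs: "r < s" "s \<le> k" for r s
  proof (rule psubsetI)
    show "codes r \<subseteq> codes s" using codes_mono rs by simp
    \<comment> \<open>Strictness comes from counting: distinct powers of the field size
      differ.\<close>
    have "card (codes r) \<noteq> card (codes s)"
      using card_codes[of r] card_codes[of s] rs card_carrier_gt_1[OF field_axioms finite_R]
      by simp
    then show "codes r \<noteq> codes s" by auto
  qed
  show ?thesis
    unfolding chain_condition_def code_dim_codes[OF order_refl]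
  proof (intro conjI exI ballI allI impI)
    show "codes k \<noteq> {\<zero>\<^bsub>vec_space R n\<^esub>}"
      using less[of 0 k] k_pos unfolding zero by auto
    show "codes 0 = {\<zero>\<^bsub>vec_space R n\<^esub>}" by (fact zero)
    show "codes r \<subset> codes (Suc r)" if "r < k" for r
      using less that by simp
    show "subcode R n (codes k) (codes r)" if "r \<in> {1..k}" for r
      using subcode_codes that by simp
    show "code_wt R n (codes r) = gen_hamming_weight R n (codes k) r" if "r \<in> {1..k}" for r
      using code_wt_codes gen_hamming_weight_codes that by simp
  qed (rule refl)
qed

end

section \<open>Existence of the codes and conclusion\<close>

lemma exists_code_with_weights:
  fixes F :: "('a, 'b) ring_scheme"
  assumes F: "field F" "finite (carrier F)" and n: "n \<le> card (carrier F)" "d k \<le> n"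
    and k: "1 \<le> k" and d: "strict_mono_on {1..k} d" "\<forall>r\<in>{1..k}. 0 < d r"
  shows "\<exists>C. linear_block_code F n C \<and> has_gen_hamming_weights F n C k d \<and> chain_condition F n C"
proof -
  interpret field F by fact
  interpret UP_domain F "UP F" by unfold_locales
  \<comment> \<open>This is where \<open>n \<le> card (carrier F)\<close> enters: it provides n
    distinct evaluation points.\<close>
  obtain \<alpha> where \<alpha>: "inj_on \<alpha> {1..n}" "\<alpha> ` {1..n} \<subseteq> carrier F"
    using card_le_inj[of "{1..n}" "carrier F"] F(2) n(1) by auto
  \<comment> \<open>This holds for every s, also outside \<open>{1..k}\<close>: if
    \<open>d s \<ge> n\<close>, the prescribed root set is empty and \<open>n - d s\<close> is 0.
    The polynomials can therefore be chosen as one function of s.\<close>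
  have "\<exists>p. p \<in> carrier (UP F) \<and> p \<noteq> \<zero>\<^bsub>UP F\<^esub> \<and> deg F p = n - d s \<and>
          (\<forall>i\<in>{1..n}. eval F F id (\<alpha> i) p = \<zero>\<^bsub>F\<^esub> \<longleftrightarrow> d s < i)" for s
  proof -
    have sub: "\<alpha> ` {d s<..n} \<subseteq> carrier F" using \<alpha>(2) by auto
    obtain p where p: "p \<in> carrier (UP F)" "p \<noteq> \<zero>\<^bsub>UP F\<^esub>" "deg F p = card (\<alpha> ` {d s<..n})"
      and roots: "\<forall>x\<in>carrier F. eval F F id x p = \<zero>\<^bsub>F\<^esub> \<longleftrightarrow> x \<in> \<alpha> ` {d s<..n}"
      using exists_poly_with_roots[OF _ sub] by blast
    have "card (\<alpha> ` {d s<..n}) = n - d s"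
      by (subst card_image) (auto intro: inj_on_subset[OF \<alpha>(1)])
    moreover have "eval F F id (\<alpha> i) p = \<zero>\<^bsub>F\<^esub> \<longleftrightarrow> d s < i" if "i \<in> {1..n}" for i
    proof -
      have "\<alpha> i \<in> \<alpha> ` {d s<..n} \<longleftrightarrow> i \<in> {d s<..n}"
        by (rule inj_on_image_mem_iff[OF \<alpha>(1) that]) auto
      moreover have "\<alpha> i \<in> carrier F" using \<alpha>(2) that by blast
      ultimately show ?thesis using roots that by simp
    qed
    ultimately show ?thesis using p by auto
  qed
  then obtain p where p: "\<And>s. p s \<in> carrier (UP F)" "\<And>s. p s \<noteq> \<zero>\<^bsub>UP F\<^esub>"
      "\<And>s. deg F (p s) = n - d s"
      "\<And>s i. i \<in> {1..n} \<Longrightarrow> eval F F id (\<alpha> i) (p s) = \<zero>\<^bsub>F\<^esub> \<longleftrightarrow> d s < i"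
    by metis
  interpret weight_code F "UP F" n k d \<alpha> p
    using F k d n \<alpha> p by unfold_locales auto
  show ?thesis
    using F subspace_codes[of k] code_dim_codes[of k] gen_hamming_weight_codes chain_condition_codes
    by (intro exI[of _ "codes k"])
      (auto simp: linear_block_code_def has_gen_hamming_weights_def)
qed

text \<open>The integers modulo a prime larger than n. This witnesses the two claims of the theorem
  that leave the field open.\<close>

lemma exists_large_finite_int_field:
  "\<exists>F :: int ring. field F \<and> finite (carrier F) \<and> n \<le> card (carrier F)"
proof -
  obtain p :: nat where p: "prime p" "n < p"
    using bigger_prime by blast
  then interpret residues_prime p "residue_ring (int p)"
    by unfold_locales auto
  show ?thesis
    using is_field p by (intro exI[of _ "residue_ring (int p)"]) (auto simp: res_carrier_eq)
qed

theorem theorem3p1: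
  fixes k :: nat and d :: "nat \<Rightarrow> nat"
  assumes "k \<ge> 1"
    and "strict_mono_on {1..k} d"
    and "\<forall>r\<in>{1..k}. d r > 0"
  shows
    "(\<exists>(F :: int ring) n C.
        linear_block_code F n C \<and> has_gen_hamming_weights F n C k d) \<and>
     (\<forall>n q. n \<ge> d k \<longrightarrow> primepow q \<longrightarrow> q \<ge> n \<longrightarrow>
        (\<forall>F :: ('a, 'b) ring_scheme. field F \<longrightarrow> card (carrier F) = q \<longrightarrow>
           (\<exists>C. linear_block_code F n C \<and> has_gen_hamming_weights F n C k d \<and>
                chain_condition F n C))) \<and>
     (\<exists>(F :: int ring) n C.
        linear_block_code F n C \<and> has_greedy_weights F n C k d)"
proof -
  obtain F :: "int ring" where F: "field F" "finite (carrier F)" "d k \<le> card (carrier F)"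
    using exists_large_finite_int_field by blast
  \<comment> \<open>The least admissible length \<open>d k\<close> is chosen; this one code serves
    both the first and the last claim.\<close>
  then obtain C where C: "linear_block_code F (d k) C"
      "has_gen_hamming_weights F (d k) C k d" "chain_condition F (d k) C"
    using exists_code_with_weights[of F "d k" d k] assms by blast
  have "code_dim F (d k) C = k" and "\<forall>r\<in>{1..k}. gen_hamming_weight F (d k) C r = d r"
    using C(2) unfolding has_gen_hamming_weights_def by blast+
  then have "has_greedy_weights F (d k) C k d"
    using chain_condition_imp_greedy_weight[OF F(1,2) C(3)] unfolding has_greedy_weights_def
    by metis
  moreover have "\<exists>C. linear_block_code F n C \<and> has_gen_hamming_weights F n C k d \<and>
      chain_condition F n C"
    if "d k \<le> n" "primepow q" "n \<le> q" "field F" "card (carrier F) = q"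
    for n q and F :: "('a, 'b) ring_scheme"
  proof -
    \<comment> \<open>An infinite carrier would have \<open>card\<close> equal to 0, whereas a prime
      power is positive.\<close>
    have "finite (carrier F)"
      using primepow_gt_0_nat[OF that(2)] that(5) by (intro card_ge_0_finite) simp
    then show ?thesis
      using exists_code_with_weights[OF that(4) _ _ that(1) assms] that(3,5) by blast
  qed
  ultimately show ?thesis
    using C by blast
qed

end
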